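(* For all positive integers $j, m, n$ with $m \geq 4$, $j \geq m$ and $n \geq 3$, \[ m_j(K_m, nK_2) = \left\lceil \frac{2n}{j+2-m} \right\rceil . \]
   Context: All graphs are finite, simple and undirected. $K_m$ is the complete graph on $m$ vertices and $nK_2$ is a set of $n$ pairwise vertex-disjoint edges (a matching of size $n$). $K_{j\times t}$ denotes the complete multipartite graph with $j$ partite sets, each having $t$ vertices. For graphs $G_1,G_2$, the multipartite Ramsey number $m_j(G_1,G_2)$ is the smallest positive integer $t$ such that for every 2-edge-coloring $(G^1,G^2)$ of $K_{j\times t}$ (that is, every partition of the edge set into two color classes, $G^i$ being the spanning subgraph formed by the edges of color $i$), $G^i$ contains a copy of $G_i$ as a (not necessarily induced) subgraph for at least one $i\in\{1,2\}$. *)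

theory Defs
  imports Complex_Main "HOL-Library.Extended_Nat"
begin

datatype 'a graph = Graph (verts: "'a set") (edges: "'a set set")

definition simple_graph :: "'a graph \<Rightarrow> bool" where
  "simple_graph G \<longleftrightarrow>
     finite (verts G) \<and> (\<forall>e\<in>edges G. e \<subseteq> verts G \<and> card e = 2)"

definition complete_graph :: "nat \<Rightarrow> nat graph" where
  "complete_graph m = Graph {..<m} {e. e \<subseteq> {..<m} \<and> card e = 2}"

definition matching_graph :: "nat \<Rightarrow> nat graph" where
  "matching_graph n = Graph {..<2 * n} {{2 * i, 2 * i + 1} | i. i < n}"

text \<open>The vertex \<open>(p, k)\<close> is the \<open>k\<close>-th vertex of the \<open>p\<close>-th partite set.\<close>

definition complete_multipartite :: "nat \<Rightarrow> nat \<Rightarrow> (nat \<times> nat) graph" where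
  "complete_multipartite j t =
     Graph ({..<j} \<times> {..<t})
       {{u, v} | u v. u \<in> {..<j} \<times> {..<t} \<and> v \<in> {..<j} \<times> {..<t} \<and> fst u \<noteq> fst v}"

definition contains_copy :: "'a graph \<Rightarrow> 'b graph \<Rightarrow> bool" where
  "contains_copy G H \<longleftrightarrow>
     (\<exists>f. inj_on f (verts H) \<and> f ` verts H \<subseteq> verts G \<and> (\<forall>e\<in>edges H. f ` e \<in> edges G))"

definition two_edge_colouring :: "'a graph \<Rightarrow> 'a graph \<Rightarrow> 'a graph \<Rightarrow> bool" where
  "two_edge_colouring G A B \<longleftrightarrow>
     verts A = verts G \<and> verts B = verts G \<and>
     edges A \<union> edges B = edges G \<and> edges A \<inter> edges B = {}"

definition ramsey_arrow :: "'a graph \<Rightarrow> 'b graph \<Rightarrow> 'c graph \<Rightarrow> bool" where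
  "ramsey_arrow G H1 H2 \<longleftrightarrow>
     (\<forall>A B. two_edge_colouring G A B \<longrightarrow> contains_copy A H1 \<or> contains_copy B H2)"

text \<open>On a nonempty set of extended naturals the infimum is the least element. The value is
  \<open>\<infinity>\<close> if no suitable \<open>t\<close> exists, so an equation with a finite value includes existence.\<close>

definition multipartite_ramsey :: "nat \<Rightarrow> 'a graph \<Rightarrow> 'b graph \<Rightarrow> enat" where
  "multipartite_ramsey j H1 H2 =
     Inf {enat t | t. 0 < t \<and> ramsey_arrow (complete_multipartite j t) H1 H2}"

lemma simple_complete_graph: "simple_graph (complete_graph m)"
  by (simp add: simple_graph_def complete_graph_def)

lemma simple_matching_graph: "simple_graph (matching_graph n)"
  by (auto simp: simple_graph_def matching_graph_def card_insert_if)

lemma simple_complete_multipartite: "simple_graph (complete_multipartite j t)"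
  by (auto simp: simple_graph_def complete_multipartite_def card_insert_if)

lemma simple_colour_classes:
  assumes "simple_graph G" "two_edge_colouring G A B"
  shows "simple_graph A" "simple_graph B"
  using assms by (auto simp: simple_graph_def two_edge_colouring_def)

end

theory Submission
  imports Defs
begin

text \<open>Let \<open>d = j + 2 - m\<close>. If \<open>t d < 2 n\<close>, put the edges meeting the first \<open>m - 2\<close> parts into the
  first class; the second class lives on the \<open>t d\<close> remaining vertices.

  Conversely let \<open>t d \<ge> 2 n\<close> and suppose that the second class has no matching of size \<open>n\<close>. Delete
  vertices lying in all maximum matchings until none is left; this removes a set \<open>S\<close>, and each
  deletion lowers the matching number by one. By Gallai's lemma the remaining vertices split into
  classes with no edge of the second colour between them, each of which a maximum matching covers
  up to one vertex. If \<open>m\<close> of these classes have distinct representatives in the parts, these span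
  a \<open>K\<^sub>m\<close> in the first colour. Otherwise, by Koenig's theorem, \<open>x\<close> classes and \<open>y\<close> parts with
  \<open>x + y < m\<close> contain all vertices outside \<open>S\<close>, so that
  \<open>t (j - y) \<le> |S| + 2 (n - 1 - |S|) + x\<close>, and \<open>t (j - y) \<le> |S| < n\<close> if \<open>x = 0\<close>; both
  contradict \<open>t d \<ge> 2 n\<close>. Koenig's theorem itself follows from the same decomposition: in a
  bipartite graph the classes carry no edges.\<close>

section \<open>Maximum matchings\<close>

text \<open>A matching is encoded as the involution that swaps the ends of its edges and fixes the
  uncovered vertices, so it has \<open>card (covered f) / 2\<close> edges.\<close>

definition matching_on :: "('a \<Rightarrow> 'a \<Rightarrow> bool) \<Rightarrow> 'a set \<Rightarrow> ('a \<Rightarrow> 'a) \<Rightarrow> bool" where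
  "matching_on E V f \<longleftrightarrow> (\<forall>x. f (f x) = x) \<and> (\<forall>x. f x \<noteq> x \<longrightarrow> x \<in> V \<and> E x (f x))"

definition covered :: "('a \<Rightarrow> 'a) \<Rightarrow> 'a set" where
  "covered f = {x. f x \<noteq> x}"

definition max_matching :: "('a \<Rightarrow> 'a \<Rightarrow> bool) \<Rightarrow> 'a set \<Rightarrow> ('a \<Rightarrow> 'a) \<Rightarrow> bool" where
  "max_matching E V f \<longleftrightarrow> matching_on E V f \<and>
     (\<forall>g. matching_on E V g \<longrightarrow> card (covered g) \<le> card (covered f))"

text \<open>Peeling off the orbits \<open>{a, f a}\<close> one by one, \<open>B\<close> collects one
  end of each. For a matching it thus picks one end of every edge.\<close>

lemma involution_split:
  assumes "finite A" and "\<And>x. f (f x) = x" and "\<And>x. x \<in> A \<Longrightarrow> f x \<noteq> x \<and> f x \<in> A"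
  obtains B where "A = B \<union> f ` B" "B \<inter> f ` B = {}"
proof -
  have "\<exists>B. A = B \<union> f ` B \<and> B \<inter> f ` B = {}"
    using assms(1,3)
  proof (induction A rule: finite_psubset_induct)
    case (psubset A)
    show ?case
    proof (cases "A = {}")
      case False
      then obtain a where a: "a \<in> A" by blast
      let ?A = "A - {a, f a}"
      have "\<exists>B. ?A = B \<union> f ` B \<and> B \<inter> f ` B = {}"
        using a psubset.prems assms(2)
        by (intro psubset.IH) (auto, metis+)
      then obtain B where B: "?A = B \<union> f ` B" "B \<inter> f ` B = {}" by blast
      have fa: "f a \<noteq> a" "f a \<in> A" using a psubset.prems by auto
      have "A = insert a B \<union> f ` insert a B" using B(1) a fa by auto
      moreover have "insert a B \<inter> f ` insert a B = {}" using B fa by auto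
      ultimately show ?thesis by blast
    qed simp
  qed
  then show ?thesis using that by blast
qed

lemma matching_on_partner:
  assumes "matching_on E V f" "x \<in> covered f"
  shows "x \<in> V" "f x \<in> V" "E x (f x)" "f x \<in> covered f" "f x \<noteq> x"
  using assms unfolding matching_on_def covered_def by auto

lemma matching_on_involution: "matching_on E V f \<Longrightarrow> f (f x) = x"
  by (simp add: matching_on_def)

lemma covered_subset: "matching_on E V f \<Longrightarrow> covered f \<subseteq> V"
  by (auto simp: matching_on_def covered_def)

lemma matching_on_split:
  assumes "matching_on E V f" "finite V"
  obtains B where "covered f = B \<union> f ` B" "B \<inter> f ` B = {}" "card (covered f) = 2 * card B"
proof -
  have fin: "finite (covered f)"
    using covered_subset[OF assms(1)] assms(2) finite_subset by blast
  obtain B where B: "covered f = B \<union> f ` B" "B \<inter> f ` B = {}"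
    using involution_split[OF fin matching_on_involution[OF assms(1)]] matching_on_partner[OF assms(1)]
    by metis
  have "inj_on f B" by (metis inj_onI matching_on_involution[OF assms(1)])
  moreover have "finite B" using fin B(1) by simp
  ultimately have "card (covered f) = 2 * card B"
    unfolding B(1) by (simp add: card_Un_disjoint B(2) card_image)
  then show ?thesis using that B by blast
qed

lemma matching_on_mono: "matching_on E V f \<Longrightarrow> V \<subseteq> W \<Longrightarrow> matching_on E W f"
  by (auto simp: matching_on_def)

lemma max_matching_exists:
  assumes "finite V"
  obtains f where "max_matching E V f"
proof -
  have "matching_on E V id" by (simp add: matching_on_def)
  moreover have "\<forall>f. matching_on E V f \<longrightarrow> card (covered f) < Suc (card V)"
    by (simp add: assms card_mono covered_subset less_Suc_eq_le)
  ultimately show ?thesis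
    using that ex_has_greatest_nat[of "matching_on E V" id "\<lambda>f. card (covered f)" "Suc (card V)"]
    unfolding max_matching_def by (metis less_imp_le)
qed

lemma matching_on_extend:
  assumes "matching_on E V f" "symp E" "f x = x" "f y = y" "x \<in> V" "y \<in> V" "x \<noteq> y" "E x y"
  shows "matching_on E V (f(x := y, y := x))" "covered (f(x := y, y := x)) = covered f \<union> {x, y}"
proof -
  have "f w \<noteq> x" "f w \<noteq> y" if "w \<noteq> x" "w \<noteq> y" for w
    using that assms(1,3,4) by (metis matching_on_involution)+
  then show "matching_on E V (f(x := y, y := x))"
    using assms unfolding matching_on_def by (auto dest: sympD)
  show "covered (f(x := y, y := x)) = covered f \<union> {x, y}"
    using assms by (auto simp: covered_def)
qed

text \<open>Otherwise the edge could be added to \<open>f\<close>. A loop of \<open>E\<close> is not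
  excluded, hence the conclusion \<open>x = y\<close>.\<close>

lemma max_matching_adjacent:
  assumes "finite V" "symp E" "max_matching E V f" "x \<in> V" "y \<in> V" "E x y" "f x = x" "f y = y"
  shows "x = y"
proof (rule ccontr)
  assume "x \<noteq> y"
  have m: "matching_on E V f" using assms(3) by (simp add: max_matching_def)
  note e = matching_on_extend[OF m assms(2,7,8,4,5) \<open>x \<noteq> y\<close> assms(6)]
  have "finite (covered f)" using covered_subset[OF m] assms(1) finite_subset by blast
  then have "card (covered f) < card (covered f \<union> {x, y})"
    using assms(7,8) \<open>x \<noteq> y\<close> by (intro psubset_card_mono) (auto simp: covered_def)
  then show False using e assms(3) unfolding max_matching_def by (metis leD)
qed

section \<open>Gallai's lemma\<close>

text \<open>Once every vertex is exposed by some maximum matching, the classes of this relation play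
  the role of the components in Gallai's lemma. The conclusion \<open>u = v\<close> in place of
  \<open>False\<close> makes the relation reflexive.\<close>

definition exposed_related :: "('a \<Rightarrow> 'a \<Rightarrow> bool) \<Rightarrow> 'a set \<Rightarrow> ('a \<times> 'a) set" where
  "exposed_related E V =
     {(u, v) \<in> V \<times> V. \<forall>f. max_matching E V f \<longrightarrow> f u = u \<longrightarrow> f v = v \<longrightarrow> u = v}"

text \<open>Gallai's exchange argument: if \<open>M\<close> exposes \<open>u\<close> and \<open>v\<close>, take \<open>N\<close> exposing \<open>t\<close> that agrees with
  \<open>M\<close> as much as possible. Some \<open>x \<noteq> t\<close> is covered by \<open>M\<close> but not by \<open>N\<close>, and replacing the edge of
  \<open>N\<close> at \<open>M x\<close> by the edge from \<open>x\<close> to \<open>M x\<close> increases the agreement.\<close>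

lemma gallai_trans:
  assumes fin: "finite V" and sym: "symp E"
    and ut: "(u, t) \<in> exposed_related E V" and tv: "(t, v) \<in> exposed_related E V"
    and ex: "\<exists>f. max_matching E V f \<and> f t = t"
  shows "(u, v) \<in> exposed_related E V"
proof -
  have V: "u \<in> V" "t \<in> V" "v \<in> V" using ut tv by (auto simp: exposed_related_def)
  have ut': "u = t" if "max_matching E V f" "f u = u" "f t = t" for f
    using ut that by (auto simp: exposed_related_def)
  have tv': "t = v" if "max_matching E V f" "f t = t" "f v = v" for f
    using tv that by (auto simp: exposed_related_def)
  have "u = v" if M: "max_matching E V M" and Mu: "M u = u" and Mv: "M v = v" for M
  proof (rule ccontr)
    assume "u \<noteq> v"
    have Mt: "M t \<noteq> t" using ut' tv' M Mu Mv \<open>u \<noteq> v\<close> by metis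
    define agree where "agree N = {w \<in> V. M w = N w}" for N
    let ?P = "\<lambda>N. max_matching E V N \<and> N t = t"
    obtain N0 where N0: "?P N0" using ex by blast
    have "\<forall>N. ?P N \<longrightarrow> card (agree N) < Suc (card V)"
      using fin by (auto simp: agree_def less_Suc_eq_le intro!: card_mono)
    from ex_has_greatest_nat[of ?P, OF N0 this]
    obtain N where N: "max_matching E V N" "N t = t"
      and Nmax: "\<And>N'. ?P N' \<Longrightarrow> card (agree N') \<le> card (agree N)" by blast
    have mM: "matching_on E V M" and mN: "matching_on E V N"
      using M N by (auto simp: max_matching_def)
    have finM: "finite (covered M)" and finN: "finite (covered N)"
      using covered_subset[OF mM] covered_subset[OF mN] fin by (auto intro: finite_subset)
    have Nu: "N u \<noteq> u" using ut'[OF N(1) _ N(2)] Mt Mu by blast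
    have Nv: "N v \<noteq> v" using tv'[OF N] Mt Mv by blast
    \<comment> \<open>\<open>M\<close> and \<open>N\<close> cover equally many vertices, and
      \<open>N\<close> covers \<open>u\<close> and \<open>v\<close>, which \<open>M\<close> misses.
      So \<open>M\<close> covers at least two vertices missed by \<open>N\<close>, one of them
      different from \<open>t\<close>.\<close>
    have "card (covered M) = card (covered N)"
      using M N(1) unfolding max_matching_def by (intro order.antisym) blast+
    moreover have "card (covered M) = card (covered M \<inter> covered N) + card (covered M - covered N)"
      by (rule card_Int_Diff[OF finM])
    moreover have "card (covered N) = card (covered M \<inter> covered N) + card (covered N - covered M)"
      by (subst Int_commute) (rule card_Int_Diff[OF finN])
    moreover have "card {u, v} \<le> card (covered N - covered M)"
      using finN Nu Nv Mu Mv by (intro card_mono) (auto simp: covered_def)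
    ultimately have "2 \<le> card (covered M - covered N)" using \<open>u \<noteq> v\<close> by simp
    then have "\<not> covered M - covered N \<subseteq> {t}"
      using card_mono[of "{t}" "covered M - covered N"] by auto
    then obtain x where x: "M x \<noteq> x" "N x = x" "x \<noteq> t" by (auto simp: covered_def)
    define y where "y = M x"
    have xc: "x \<in> covered M" using x by (simp add: covered_def)
    have xy: "x \<in> V" "y \<in> V" "E x y" "x \<noteq> y" "M y = x"
      using matching_on_partner[OF mM xc] matching_on_involution[OF mM] by (auto simp: y_def)
    have Ny: "N y \<noteq> y" using max_matching_adjacent[OF fin sym N(1) xy(1,2,3) x(2)] xy(4) by blast
    define z where "z = N y"
    have Nz: "N z = y" using matching_on_involution[OF mN] by (simp add: z_def)
    have z: "z \<noteq> y" "z \<noteq> x" "z \<noteq> t" "y \<noteq> t" "z \<in> V"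
      using Ny Nz x(2) N(2) matching_on_partner[OF mN, of y] xy
      by (auto simp: z_def covered_def)
    \<comment> \<open>The edge \<open>yz\<close> of \<open>N\<close> is exchanged for
      \<open>xy\<close>: now \<open>z\<close> is exposed instead of \<open>x\<close>, and
      \<open>t\<close> remains exposed.\<close>
    define N' where "N' = N(x := y, y := x, z := z)"
    have oth: "N w \<noteq> x" "N w \<noteq> y" "N w \<noteq> z" if "w \<noteq> x" "w \<noteq> y" "w \<noteq> z" for w
      using that x(2) z_def Nz matching_on_involution[OF mN] by metis+
    have "matching_on E V N'"
      using mN xy z oth sym unfolding matching_on_def N'_def by (auto dest: sympD)
    moreover have "covered N' = insert x (covered N - {z})"
      using x xy z Ny Nz by (auto simp: covered_def N'_def)
    then have "card (covered N') = card (covered N)"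
      using finN x(2) Nz z(1) card.remove[of "covered N" z]
      by (subst \<open>covered N' = _\<close>, subst card_insert_disjoint) (auto simp: covered_def)
    ultimately have "max_matching E V N'" using N(1) by (simp add: max_matching_def)
    moreover have "N' t = t" using N(2) x z by (simp add: N'_def)
    ultimately have "card (agree N') \<le> card (agree N)" using Nmax by blast
    \<comment> \<open>No agreement is lost: \<open>N\<close> differs from \<open>M\<close> at
      \<open>x\<close>, \<open>y\<close> and \<open>z\<close>, the only places where
      \<open>N'\<close> differs from \<open>N\<close>.\<close>
    moreover have "M z \<noteq> y" using xy(5) z(2) matching_on_involution[OF mM] by metis
    then have "agree N \<subseteq> agree N'" using xy z x Nz by (auto simp: agree_def N'_def y_def z_def)
    moreover have "x \<in> agree N' - agree N" using xy x z by (auto simp: agree_def N'_def y_def)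
    ultimately show False
      using fin psubset_card_mono[of "agree N'" "agree N"] by (auto simp: agree_def)
  qed
  then show ?thesis using V by (auto simp: exposed_related_def)
qed

text \<open>Exposability of all vertices enters through transitivity, where the exchange argument
  needs a maximum matching exposing the middle vertex.\<close>

lemma equiv_exposed_related:
  assumes "finite V" "symp E" "\<And>v. v \<in> V \<Longrightarrow> \<exists>f. max_matching E V f \<and> f v = v"
  shows "equiv V (exposed_related E V)"
proof (rule equivI)
  show "refl_on V (exposed_related E V)" by (auto simp: refl_on_def exposed_related_def)
  show "sym (exposed_related E V)" by (auto simp: sym_def exposed_related_def)
  show "trans (exposed_related E V)"
    using gallai_trans[OF assms(1,2)] assms(3)
    by (intro transI) (metis (no_types, lifting) SigmaE case_prodD exposed_related_def mem_Collect_eq prod.inject mem_Sigma_iff)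
qed (auto simp: exposed_related_def)

text \<open>Hence no edge joins two different classes.\<close>

lemma adjacent_exposed_related:
  assumes "finite V" "symp E" "x \<in> V" "y \<in> V" "E x y"
  shows "(x, y) \<in> exposed_related E V"
  using max_matching_adjacent[OF assms(1,2) _ assms(3,4,5)] assms(3,4)
  by (auto simp: exposed_related_def)

lemma berge_witness:
  assumes "finite V" "max_matching E V f"
  obtains S g where "S \<subseteq> V" "max_matching E (V - S) g" "card (covered g) + 2 * card S \<le> card (covered f)"
    "\<And>v. v \<in> V - S \<Longrightarrow> \<exists>h. max_matching E (V - S) h \<and> h v = v"
proof -
  have "\<exists>S g. S \<subseteq> V \<and> max_matching E (V - S) g \<and> card (covered g) + 2 * card S \<le> card (covered f) \<and>
    (\<forall>v \<in> V - S. \<exists>h. max_matching E (V - S) h \<and> h v = v)"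
    using assms
  proof (induction V arbitrary: f rule: finite_psubset_induct)
    case (psubset V)
    show ?case
    proof (cases "\<forall>v\<in>V. \<exists>h. max_matching E V h \<and> h v = v")
      case True
      then show ?thesis using psubset.prems by (intro exI[of _ "{}"] exI[of _ f]) auto
    next
      case False
      then obtain v where v: "v \<in> V" "\<And>h. max_matching E V h \<Longrightarrow> h v \<noteq> v" by blast
      obtain h where h: "max_matching E (V - {v}) h"
        using max_matching_exists psubset.hyps by (metis finite_Diff)
      have mh: "matching_on E (V - {v}) h" using h by (simp add: max_matching_def)
      then have mh': "matching_on E V h" using matching_on_mono by blast
      have "h v = v" using mh by (auto simp: matching_on_def)
      \<comment> \<open>Seen in \<open>V\<close>, \<open>h\<close> is a matching that exposes
        \<open>v\<close>, so it is not maximum. By parity the loss is at least two.\<close>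
      then have "card (covered h) < card (covered f)"
        using v(2)[of h] mh' psubset.prems unfolding max_matching_def
        by (metis le_trans linorder_not_le)
      moreover have "even (card (covered h))" "even (card (covered f))"
        using matching_on_split mh' psubset.prems psubset.hyps unfolding max_matching_def
        by (metis dvd_triv_left)+
      ultimately have lt: "card (covered h) + 2 \<le> card (covered f)"
        unfolding dvd_def by fastforce
      have "V - {v} \<subset> V" using v(1) by blast
      from psubset.IH[OF this h] obtain S g where S: "S \<subseteq> V - {v}" "max_matching E (V - {v} - S) g"
        "card (covered g) + 2 * card S \<le> card (covered h)"
        "\<forall>w \<in> V - {v} - S. \<exists>h. max_matching E (V - {v} - S) h \<and> h w = w" by blast
      have "V - {v} - S = V - insert v S" by blast
      moreover have "card (insert v S) = Suc (card S)"
        using S(1) psubset.hyps finite_subset[of S V] by (subst card_insert_disjoint) auto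
      ultimately show ?thesis using S lt v(1)
        by (intro exI[of _ "insert v S"] exI[of _ g]) auto
    qed
  qed
  then show ?thesis using that by blast
qed

section \<open>Koenig's theorem\<close>

text \<open>A maximum matching exposing \<open>x\<close> covers the rest of \<open>K\<close>, along
  edges that stay in \<open>K\<close> and change sides. It maps the side opposite to
  \<open>x\<close> injectively into the side of \<open>x\<close>, missing \<open>x\<close>.\<close>

lemma bipartite_class_card:
  assumes fin: "finite V" and sym: "symp E"
    and inessential: "\<And>v. v \<in> V \<Longrightarrow> \<exists>f. max_matching E V f \<and> f v = v"
    and bip: "\<And>a b. a \<in> V \<Longrightarrow> b \<in> V \<Longrightarrow> E a b \<Longrightarrow> L a \<longleftrightarrow> \<not> L b"
    and x: "x \<in> K" "L x" and K: "K \<in> V // exposed_related E V"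
  shows "card {w \<in> K. \<not> L w} < card {w \<in> K. L w}"
proof -
  note eq = equiv_exposed_related[OF fin sym inessential]
  have KV: "K \<subseteq> V" using K eq by (rule in_quotient_imp_subset[rotated])
  then have finK: "finite K" using fin finite_subset by blast
  obtain f where f: "max_matching E V f" "f x = x" using inessential x KV by blast
  have mf: "matching_on E V f" using f by (simp add: max_matching_def)
  have "f w \<in> {w \<in> K. L w} - {x}" if w: "w \<in> K" "\<not> L w" for w
  proof -
    have "(w, x) \<in> exposed_related E V" using eq K w(1) x(1) by (auto dest: in_quotient_imp_in_rel)
    then have "w \<in> covered f" using f w x by (auto simp: exposed_related_def covered_def)
    note p = matching_on_partner[OF mf this]
    have "(w, f w) \<in> exposed_related E V" using adjacent_exposed_related[OF fin sym p(1,2,3)] .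
    then have "f w \<in> K" using in_quotient_imp_closed[OF eq K w(1)] by blast
    moreover have "L (f w)" using bip[OF p(1,2,3)] w by simp
    moreover have "f w \<noteq> x" using p(5) f(2) matching_on_involution[OF mf] by metis
    ultimately show ?thesis by blast
  qed
  moreover have "inj_on f {w \<in> K. \<not> L w}" by (metis inj_onI matching_on_involution[OF mf])
  ultimately have "card {w \<in> K. \<not> L w} \<le> card ({w \<in> K. L w} - {x})"
    using finK by (intro card_inj_on_le[of f]) auto
  also have "\<dots> < card {w \<in> K. L w}" using finK x by (intro card_Diff1_less) auto
  finally show ?thesis .
qed

text \<open>The deleted set \<open>S\<close> is a vertex cover: an edge outside \<open>S\<close>
  would give a class meeting both sides, and counting from either side yields opposite strict
  inequalities. So \<open>S\<close> has at least \<open>m\<close> elements, and a maximum matching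
  has at least as many edges as \<open>S\<close> has elements.\<close>

lemma koenig:
  fixes P :: "'a \<Rightarrow> 'b \<Rightarrow> bool"
  assumes "finite A" "finite B"
    and nocover: "\<And>X Y. X \<subseteq> A \<Longrightarrow> Y \<subseteq> B \<Longrightarrow> card X + card Y < m \<Longrightarrow>
      \<exists>a\<in>A - X. \<exists>b\<in>B - Y. P a b"
  obtains D g where "D \<subseteq> A" "card D = m" "inj_on g D" "\<And>a. a \<in> D \<Longrightarrow> g a \<in> B \<and> P a (g a)"
proof -
  define V where "V = Inl ` A \<union> Inr ` B"
  define E where "E u v = (case (u, v) of (Inl a, Inr b) \<Rightarrow> P a b | (Inr b, Inl a) \<Rightarrow> P a b | _ \<Rightarrow> False)"
    for u v :: "'a + 'b"
  have sym: "symp E" by (rule sympI) (auto simp: E_def split: sum.splits)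
  have fin: "finite V" using assms by (simp add: V_def)
  have bip: "isl u \<longleftrightarrow> \<not> isl v" if "E u v" for u v
    using that by (auto simp: E_def split: sum.splits)
  obtain f where f: "max_matching E V f" using max_matching_exists[OF fin] .
  have mf: "matching_on E V f" using f by (simp add: max_matching_def)
  obtain S h where S: "S \<subseteq> V" "max_matching E (V - S) h" "card (covered h) + 2 * card S \<le> card (covered f)"
    and iness: "\<And>v. v \<in> V - S \<Longrightarrow> \<exists>h. max_matching E (V - S) h \<and> h v = v"
    using berge_witness[OF fin f] by blast
  have cover: "\<not> E u v" if uv: "u \<in> V - S" "v \<in> V - S" "isl u" for u v
  proof
    assume "E u v"
    have finW: "finite (V - S)" using fin by simp
    note eq = equiv_exposed_related[OF finW sym iness]
    define K where "K = exposed_related E (V - S) `` {u}"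
    have K: "K \<in> (V - S) // exposed_related E (V - S)" using uv by (auto simp: K_def intro: quotientI)
    have "u \<in> K" using equiv_class_self[OF eq] uv by (simp add: K_def)
    moreover have "v \<in> K"
      using adjacent_exposed_related[OF finW sym uv(1,2) \<open>E u v\<close>] by (simp add: K_def)
    moreover have "\<not> isl v" using bip \<open>E u v\<close> uv by blast
    ultimately have "card {w \<in> K. \<not> isl w} < card {w \<in> K. isl w}"
      "card {w \<in> K. \<not> \<not> isl w} < card {w \<in> K. \<not> isl w}"
      using bipartite_class_card[OF finW sym iness _ _ _ K, of isl u]
        bipartite_class_card[OF finW sym iness _ _ _ K, of "\<lambda>w. \<not> isl w" v] bip uv by blast+
    then show False by simp
  qed
  define X where "X = {a. Inl a \<in> S}"
  define Y where "Y = {b. Inr b \<in> S}"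
  have XY: "X \<subseteq> A" "Y \<subseteq> B" using S(1) by (auto simp: X_def Y_def V_def)
  have "S = Inl ` X \<union> Inr ` Y"
  proof (rule set_eqI)
    show "s \<in> S \<longleftrightarrow> s \<in> Inl ` X \<union> Inr ` Y" for s by (cases s) (auto simp: X_def Y_def)
  qed
  then have "card S = card X + card Y"
    using XY assms finite_subset
    by (simp, subst card_Un_disjoint) (auto simp: card_image finite_subset)
  moreover have "\<not> card X + card Y < m"
  proof
    assume "card X + card Y < m"
    from nocover[OF XY this] obtain a b where "a \<in> A - X" "b \<in> B - Y" "P a b" by blast
    then show False using cover[of "Inl a" "Inr b"] by (auto simp: V_def X_def Y_def E_def)
  qed
  ultimately have m: "2 * m \<le> card (covered f)" using S(3) by simp
  \<comment> \<open>\<open>C\<close> holds the left end of each matching edge, so it has half the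
    size of \<open>covered f\<close>.\<close>
  define C where "C = {w \<in> covered f. isl w}"
  have finc: "finite (covered f)" using covered_subset[OF mf] fin finite_subset by blast
  have inj: "inj f" by (metis injI matching_on_involution[OF mf])
  have flip: "isl (f w) \<longleftrightarrow> \<not> isl w" if "w \<in> covered f" for w
    using bip matching_on_partner[OF mf that] by blast
  have "covered f \<subseteq> C \<union> f ` C"
  proof
    fix w assume w: "w \<in> covered f"
    show "w \<in> C \<union> f ` C"
    proof (cases "isl w")
      case False
      then have "f w \<in> C" using w flip matching_on_partner[OF mf] by (auto simp: C_def)
      then show ?thesis using matching_on_involution[OF mf, of w] by (metis UnI2 image_eqI)
    qed (use w in \<open>simp add: C_def\<close>)
  qed
  then have "card (covered f) \<le> card (C \<union> f ` C)" using finc by (intro card_mono) (auto simp: C_def)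
  also have "\<dots> \<le> card C + card (f ` C)" by (rule card_Un_le)
  also have "\<dots> = 2 * card C" using inj by (simp add: card_image inj_on_subset)
  finally have "m \<le> card C" using m by simp
  moreover have "inj_on projl C" by (auto simp: inj_on_def C_def intro: sum.expand)
  ultimately have "m \<le> card (projl ` C)" by (simp add: card_image)
  then obtain D where D: "D \<subseteq> projl ` C" "card D = m" "finite D" by (rule obtain_subset_with_card_n)
  have DC: "Inl a \<in> C" if "a \<in> D" for a using that D(1) by (auto simp: C_def)
  define g where "g a = projr (f (Inl a))" for a
  have fg: "f (Inl a) = Inr (g a)" if "a \<in> D" for a
    using DC[OF that] flip[of "Inl a"] by (auto simp: C_def g_def)
  show ?thesis
  proof (rule that)
    show "D \<subseteq> A" using DC covered_subset[OF mf] by (auto simp: C_def V_def)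
    show "card D = m" by fact
    show "inj_on g D" using fg inj by (metis inj_onI injD sum.inject(1))
    show "g a \<in> B \<and> P a (g a)" if "a \<in> D" for a
      using DC[OF that] fg[OF that] matching_on_partner[OF mf, of "Inl a"]
      by (auto simp: C_def V_def E_def)
  qed
qed

section \<open>The multipartite Ramsey number\<close>

text \<open>In the application \<open>E\<close> is the second colour and \<open>c\<close> gives the
  part, so \<open>K\<close> spans a clique of the first colour. Koenig's theorem is applied to
  classes against parts, a class being joined to the parts that it meets.\<close>

lemma independent_transversal:
  fixes E :: "'a \<Rightarrow> 'a \<Rightarrow> bool" and c :: "'a \<Rightarrow> 'b"
  assumes fin: "finite V" and sym: "symp E" and finI: "finite I"
    and parts: "\<And>i. i \<in> I \<Longrightarrow> card {v \<in> V. c v = i} = t" and cV: "c ` V \<subseteq> I"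
    and mI: "m \<le> card I" and tn: "2 * n \<le> t * (card I + 2 - m)"
    and small: "\<And>f. matching_on E V f \<Longrightarrow> card (covered f) < 2 * n"
  obtains K where "K \<subseteq> V" "card K = m" "inj_on c K" "\<And>u v. u \<in> K \<Longrightarrow> v \<in> K \<Longrightarrow> u \<noteq> v \<Longrightarrow> \<not> E u v"
proof -
  obtain f where f: "max_matching E V f" using max_matching_exists[OF fin] .
  have mf: "matching_on E V f" using f by (simp add: max_matching_def)
  obtain S h where S: "S \<subseteq> V" "max_matching E (V - S) h" "card (covered h) + 2 * card S \<le> card (covered f)"
    and iness: "\<And>v. v \<in> V - S \<Longrightarrow> \<exists>h. max_matching E (V - S) h \<and> h v = v"
    using berge_witness[OF fin f] by blast
  have finW: "finite (V - S)" using fin by simp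
  define r where "r = exposed_related E (V - S)"
  have eq: "equiv (V - S) r" unfolding r_def by (rule equiv_exposed_related[OF finW sym iness])
  \<comment> \<open>Parity improves the strict bound \<open>small\<close> by one more.\<close>
  obtain p where "card (covered f) = 2 * p" using matching_on_split[OF mf fin] by metis
  then have n: "card (covered f) + 2 \<le> 2 * n" using small[OF mf] by simp
  have mh: "matching_on E (V - S) h" using S by (simp add: max_matching_def)
  have finS: "finite S" and finh: "finite (covered h)"
    using S(1) fin finite_subset covered_subset[OF mh] finW by blast+
  have finQ: "finite ((V - S) // r)"
    using finW eq by (intro finite_quotient) (auto dest: equiv_type)
  have nocover: "\<exists>C\<in>(V - S) // r - X. \<exists>i\<in>I - Y. \<exists>v\<in>C. c v = i"
    if X: "X \<subseteq> (V - S) // r" and Y: "Y \<subseteq> I" and less: "card X + card Y < m" for X Y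
  proof (rule ccontr)
    assume neg: "\<not> ?thesis"
    \<comment> \<open>A cover by classes \<open>X\<close> and parts \<open>Y\<close> forces every
      vertex of \<open>T\<close> into \<open>S\<close> or into a class of \<open>X\<close>.\<close>
    define T where "T = {v \<in> V. c v \<in> I - Y}"
    have "T = (\<Union>i\<in>I - Y. {v \<in> V. c v = i})" by (auto simp: T_def)
    then have "card T = (\<Sum>i\<in>I - Y. card {v \<in> V. c v = i})"
      using fin finI by (simp, intro card_UN_disjoint) auto
    also have "\<dots> = t * (card I - card Y)"
      using parts finI Y by (simp add: card_Diff_subset finite_subset)
    finally have cT: "card T = t * (card I - card Y)" .
    have finX: "finite X" using X finQ finite_subset by blast
    have XW: "C \<subseteq> V - S" if "C \<in> X" for C using that X in_quotient_imp_subset[OF eq] by blast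
    then have finC: "finite C" if "C \<in> X" for C using that finW finite_subset by blast
    have TX: "T \<subseteq> S \<union> \<Union>X"
    proof
      fix v assume v: "v \<in> T"
      show "v \<in> S \<union> \<Union>X"
      proof (cases "v \<in> S")
        case False
        then have vW: "v \<in> V - S" using v by (simp add: T_def)
        then have "r `` {v} \<in> (V - S) // r" "v \<in> r `` {v}"
          using equiv_class_self[OF eq vW] by (auto intro: quotientI)
        moreover have "c v \<in> I - Y" using v by (simp add: T_def)
        ultimately have "r `` {v} \<in> X" using neg by blast
        then show ?thesis using \<open>v \<in> r `` {v}\<close> by blast
      qed simp
    qed
    have finU: "finite (\<Union>X)" using finX finC by (rule finite_Union)
    \<comment> \<open>As \<open>h\<close> is maximum, it cannot expose two different vertices of one
      class.\<close>
    have one: "card (C - covered h) \<le> 1" if "C \<in> X" for C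
    proof -
      have "u = v" if "u \<in> C - covered h" "v \<in> C - covered h" for u v
      proof -
        have "(u, v) \<in> r" using that \<open>C \<in> X\<close> X in_quotient_imp_in_rel[OF eq, of C u v] by blast
        then show ?thesis using that S(2) by (auto simp: r_def exposed_related_def covered_def)
      qed
      then show ?thesis using finC[OF \<open>C \<in> X\<close>] by (simp add: card_le_Suc0_iff_eq)
    qed
    have "\<Union>X \<subseteq> covered h \<union> (\<Union>C\<in>X. C - covered h)" by blast
    then have "card (\<Union>X) \<le> card (covered h \<union> (\<Union>C\<in>X. C - covered h))"
      using finh finX finC by (intro card_mono) auto
    also have "\<dots> \<le> card (covered h) + card (\<Union>C\<in>X. C - covered h)" by (rule card_Un_le)
    also have "card (\<Union>C\<in>X. C - covered h) \<le> (\<Sum>C\<in>X. card (C - covered h))"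
      by (rule card_UN_le[OF finX])
    also have "\<dots> \<le> card X" using sum_mono[of X, OF one] by simp
    finally have U: "card (\<Union>X) \<le> card (covered h) + card X" by simp
    have "card T \<le> card (S \<union> \<Union>X)" using TX finS finU by (intro card_mono) auto
    also have "\<dots> \<le> card S + card (\<Union>X)" by (rule card_Un_le)
    finally have le: "t * (card I - card Y) \<le> card S + card (\<Union>X)" by (simp add: cT)
    have t: "1 \<le> t" using n tn by (cases t) auto
    show False
    proof (cases "card X")
      \<comment> \<open>Here \<open>T\<close> lies in \<open>S\<close>, which has fewer than
        \<open>n\<close> elements, while \<open>card Y < m <= card I\<close> gives
        \<open>card I + 2 - m <= 2 * (card I - card Y)\<close>.\<close>
      case 0
      then have "2 * (t * (card I - card Y)) \<le> 2 * card S" using le finX by simp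
      moreover have "t * (card I + 2 - m) \<le> t * (2 * (card I - card Y))"
        using less mI by (intro mult_le_mono2) simp
      ultimately show False using S(3) n tn by simp
    next
      case (Suc x)
      \<comment> \<open>With \<open>x + 1\<close> classes, at most \<open>m - 2 - x\<close> parts
        are in \<open>Y\<close>. So \<open>T\<close> has at least \<open>2 * n + x\<close> vertices,
        but \<open>S\<close> and the classes have at most \<open>2 * n - 1 + x\<close>.\<close>
      have "t * (card I + 2 - m) + x \<le> t * (card I + 2 - m) + t * x" using t by simp
      also have "\<dots> = t * (card I + 2 - m + x)" by (simp add: distrib_left)
      also have "\<dots> \<le> t * (card I - card Y)" using less mI Suc by (intro mult_le_mono2) simp
      finally show False using le U S(3) n tn Suc by simp
    qed
  qed
  obtain D g where D: "D \<subseteq> (V - S) // r" "card D = m" "inj_on g D"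
    and g: "\<And>C. C \<in> D \<Longrightarrow> g C \<in> I \<and> (\<exists>v\<in>C. c v = g C)"
    using koenig[where P = "\<lambda>C i. \<exists>v\<in>C. c v = i", OF finQ finI nocover] by blast
  \<comment> \<open>One vertex is taken from each class of \<open>D\<close>, in its assigned part:
    distinct classes give distinct parts and non-adjacent vertices.\<close>
  obtain w where w: "\<And>C. C \<in> D \<Longrightarrow> w C \<in> C \<and> c (w C) = g C" using g by metis
  have wW: "w C \<in> V - S" if "C \<in> D" for C
    using w[OF that] D(1) that in_quotient_imp_subset[OF eq] by blast
  show ?thesis
  proof (rule that)
    show "w ` D \<subseteq> V" using wW by blast
    have "inj_on w D" using w D(3) unfolding inj_on_def by metis
    then show "card (w ` D) = m" using D(2) by (simp add: card_image)
    show "inj_on c (w ` D)" using w D(3) by (auto simp: inj_on_def)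
    show "\<not> E u v" if uv: "u \<in> w ` D" "v \<in> w ` D" "u \<noteq> v" for u v
    proof
      assume "E u v"
      obtain C C' where C: "C \<in> D" "C' \<in> D" "u = w C" "v = w C'" using uv by blast
      have "(u, v) \<in> r"
        using adjacent_exposed_related[OF finW sym _ _ \<open>E u v\<close>] wW C by (simp add: r_def)
      then have "C = C'" using quotient_eqI[OF eq _ _ _ _ \<open>(u, v) \<in> r\<close>] C D(1) w by blast
      then show False using C uv(3) by simp
    qed
  qed
qed

section \<open>Upper bound\<close>

lemma matching_copy:
  assumes fin: "finite V" and f: "matching_on E V f" "2 * n \<le> card (covered f)"
    and VG: "V \<subseteq> verts G" and EG: "\<And>u v. E u v \<Longrightarrow> {u, v} \<in> edges G"
  shows "contains_copy G (matching_graph n)"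
proof -
  obtain B where B: "covered f = B \<union> f ` B" "B \<inter> f ` B = {}" "card (covered f) = 2 * card B"
    using matching_on_split[OF f(1) fin] .
  have "finite B" using B(1) covered_subset[OF f(1)] fin by (metis finite_Un finite_subset)
  then obtain b where b: "bij_betw b {0..<card B} B" using ex_bij_betw_nat_finite by blast
  have nB: "n \<le> card B" using f(2) B(3) by simp
  have bB: "b i \<in> B" if "i < n" for i using that nB b by (auto simp: bij_betw_def)
  have binj: "b i = b k \<longleftrightarrow> i = k" if "i < n" "k < n" for i k
    using that nB b by (auto simp: bij_betw_def inj_on_def)
  have finj: "f x = f y \<longleftrightarrow> x = y" for x y by (metis matching_on_involution[OF f(1)])
  have bf: "b i \<noteq> f (b k)" if "i < n" "k < n" for i k using bB that B(2) by blast
  \<comment> \<open>The numbers \<open>2 * i\<close> and \<open>2 * i + 1\<close> go to the two ends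
    of the \<open>i\<close>-th edge.\<close>
  define h where "h i = (if even i then b (i div 2) else f (b (i div 2)))" for i
  have "inj_on h {..<2 * n}"
  proof (rule inj_onI)
    fix x y assume xy: "x \<in> {..<2 * n}" "y \<in> {..<2 * n}" "h x = h y"
    then have lt: "x div 2 < n" "y div 2 < n" by auto
    have "x div 2 = y div 2" "even x \<longleftrightarrow> even y"
      using bf[OF lt] bf[OF lt(2,1)] binj[OF lt] finj xy(3)
      by (auto simp: h_def split: if_splits)
    then show "x = y" by presburger
  qed
  moreover have cov: "b i \<in> covered f" if "i < n" for i using bB[OF that] B(1) by blast
  then have "h ` {..<2 * n} \<subseteq> verts G"
    using matching_on_partner[OF f(1) cov] VG by (auto simp: h_def)
  moreover have "h ` {2 * i, 2 * i + 1} \<in> edges G" if "i < n" for i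
    using EG[OF matching_on_partner(3)[OF f(1) cov[OF that]]]
    by (simp add: h_def insert_commute)
  ultimately show ?thesis unfolding contains_copy_def matching_graph_def by auto
qed

lemma ramsey_arrow_upper:
  assumes "m \<le> j" "2 * n \<le> t * (j + 2 - m)"
  shows "ramsey_arrow (complete_multipartite j t) (complete_graph m) (matching_graph n)"
  unfolding ramsey_arrow_def
proof (intro allI impI)
  fix A B assume col: "two_edge_colouring (complete_multipartite j t) A B"
  define V where "V = {..<j} \<times> {..<t}"
  have V: "verts A = V" "verts B = V" using col
    by (auto simp: two_edge_colouring_def complete_multipartite_def V_def)
  define E where "E u v \<longleftrightarrow> {u, v} \<in> edges B" for u v
  have fin: "finite V" by (simp add: V_def)
  have sym: "symp E" by (auto simp: symp_def E_def insert_commute)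
  show "contains_copy A (complete_graph m) \<or> contains_copy B (matching_graph n)"
  proof (cases "\<exists>f. matching_on E V f \<and> 2 * n \<le> card (covered f)")
    case True
    then show ?thesis using matching_copy[OF fin, of E _ n B] V by (auto simp: E_def)
  next
    case False
    have part: "card {v \<in> V. fst v = i} = t" if "i \<in> {..<j}" for i
    proof -
      have "{v \<in> V. fst v = i} = {i} \<times> {..<t}" using that by (auto simp: V_def)
      then show ?thesis by (simp add: card_cartesian_product)
    qed
    have small: "card (covered f) < 2 * n" if "matching_on E V f" for f
      using False that by (meson not_le)
    have cV: "fst ` V \<subseteq> {..<j}" by (auto simp: V_def)
    have assms': "m \<le> card {..<j}" "2 * n \<le> t * (card {..<j} + 2 - m)" using assms by simp_all
    obtain K where K: "K \<subseteq> V" "card K = m" "inj_on fst K"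
      "\<And>u v. u \<in> K \<Longrightarrow> v \<in> K \<Longrightarrow> u \<noteq> v \<Longrightarrow> \<not> E u v"
      using independent_transversal[OF fin sym finite_lessThan part cV assms' small] by metis
    have "finite K" using fin by (rule finite_subset[OF K(1)])
    then obtain b where b: "bij_betw b {0..<m} K"
      using K(2) ex_bij_betw_nat_finite by blast
    have "b ` e \<in> edges A" if e: "e \<subseteq> {..<m}" "card e = 2" for e
    proof -
      obtain x y where xy: "e = {x, y}" "x \<noteq> y" using e(2) by (meson card_2_iff)
      have bK: "b x \<in> K" "b y \<in> K" "b x \<noteq> b y"
        using xy e(1) b by (auto simp: bij_betw_def inj_on_def)
      then have "fst (b x) \<noteq> fst (b y)" using K(3) by (auto dest: inj_onD)
      then have "{b x, b y} \<in> edges (complete_multipartite j t)"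
        using bK K(1) unfolding complete_multipartite_def V_def graph.sel by blast
      then show ?thesis using K(4)[OF bK] col xy by (auto simp: two_edge_colouring_def E_def)
    qed
    moreover have "inj_on b {..<m}" "b ` {..<m} \<subseteq> verts A"
      using b K(1) V by (auto simp: bij_betw_def atLeast0LessThan)
    ultimately show ?thesis by (auto simp: contains_copy_def complete_graph_def)
  qed
qed

section \<open>Lower bound\<close>

lemma not_ramsey_arrow_lower:
  assumes "2 \<le> m" "m \<le> j" "t * (j + 2 - m) < 2 * n"
  shows "\<not> ramsey_arrow (complete_multipartite j t) (complete_graph m) (matching_graph n)"
proof
  assume arrow: "ramsey_arrow (complete_multipartite j t) (complete_graph m) (matching_graph n)"
  define G where "G = complete_multipartite j t"
  define late where "late e \<longleftrightarrow> (\<forall>v\<in>e. m - 2 \<le> fst v)" for e :: "(nat \<times> nat) set"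
  define A where "A = Graph (verts G) {e \<in> edges G. \<not> late e}"
  define B where "B = Graph (verts G) {e \<in> edges G. late e}"
  have "two_edge_colouring G A B"
    unfolding two_edge_colouring_def A_def B_def by auto
  then consider "contains_copy A (complete_graph m)" | "contains_copy B (matching_graph n)"
    using arrow by (auto simp: ramsey_arrow_def G_def)
  then show False
  proof cases
    case 1
    then obtain f where f: "\<forall>e. e \<subseteq> {..<m} \<and> card e = 2 \<longrightarrow> f ` e \<in> edges A"
      by (auto simp: contains_copy_def complete_graph_def)
    define p where "p i = fst (f i)" for i
    have pair: "p x \<noteq> p y \<and> (p x < m - 2 \<or> p y < m - 2)" if "x < m" "y < m" "x \<noteq> y" for x y
      using f[rule_format, of "{x, y}"] that
      by (auto simp: A_def late_def G_def complete_multipartite_def p_def doubleton_eq_iff)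
    \<comment> \<open>A clique of the first colour has at most one vertex in the late parts and at
      most one in each of the \<open>m - 2\<close> early parts, hence fewer than \<open>m\<close> in
      all.\<close>
    define Z where "Z = {x. x < m \<and> m - 2 \<le> p x}"
    have "card Z \<le> 1"
      using pair by (auto simp: Z_def card_le_Suc0_iff_eq) (metis not_le)
    moreover have "card ({..<m} - Z) \<le> card {..<m - 2}"
    proof (rule card_inj_on_le)
      show "inj_on p ({..<m} - Z)" by (rule inj_onI) (use pair in blast)
      show "p ` ({..<m} - Z) \<subseteq> {..<m - 2}" by (auto simp: Z_def)
    qed simp
    moreover have "card ({..<m} - Z) = m - card Z"
      by (subst card_Diff_subset) (auto simp: Z_def)
    ultimately show False using assms by simp
  next
    case 2
    then obtain f where f: "inj_on f (verts (matching_graph n))"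
      "\<forall>e\<in>edges (matching_graph n). f ` e \<in> edges B"
      unfolding contains_copy_def by blast
    have inj: "inj_on f {..<2 * n}" using f(1) by (simp add: matching_graph_def)
    have edge: "f ` {2 * i, 2 * i + 1} \<in> edges B" if "i < n" for i
    proof -
      have "{2 * i, 2 * i + 1} \<in> edges (matching_graph n)"
        using that by (auto simp: matching_graph_def)
      with f(2) show ?thesis by (rule bspec)
    qed
    \<comment> \<open>Every vertex of the matching graph is an end of the edge with index
      \<open>x div 2\<close>, so its image lies in a late part.\<close>
    have range: "f x \<in> {m - 2..<j} \<times> {..<t}" if x: "x < 2 * n" for x
    proof -
      have "x \<in> {2 * (x div 2), 2 * (x div 2) + 1}" by auto
      then have "f x \<in> f ` {2 * (x div 2), 2 * (x div 2) + 1}" by (rule imageI)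
      moreover have "f ` {2 * (x div 2), 2 * (x div 2) + 1} \<in> edges B"
        using x by (intro edge) simp
      ultimately obtain e where "e \<in> edges B" "f x \<in> e" by (rule that[rotated])
      then show ?thesis
        by (cases "f x") (auto simp: B_def late_def G_def complete_multipartite_def)
    qed
    have "card {..<2 * n} \<le> card ({m - 2..<j} \<times> {..<t})"
    proof (rule card_inj_on_le[OF inj])
      show "f ` {..<2 * n} \<subseteq> {m - 2..<j} \<times> {..<t}" by (intro image_subsetI range) simp
    qed simp
    moreover have "j - (m - 2) = j + 2 - m" using assms by simp
    ultimately show False using assms by (simp add: card_cartesian_product mult.commute)
  qed
qed

theorem theorem1:
  fixes j m n :: nat
  assumes "m \<ge> 4" and "j \<ge> m" and "n \<ge> 3"
  shows "multipartite_ramsey j (complete_graph m) (matching_graph n) =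
           enat (nat \<lceil>2 * real n / (real j + 2 - real m)\<rceil>)"
proof -
  define d where "d = j + 2 - m"
  have d: "real j + 2 - real m = real d" "0 < d" using assms by (simp_all add: d_def)
  define T where "T = nat \<lceil>2 * real n / real d\<rceil>"
  \<comment> \<open>Clearing the denominator shows that the ceiling is the least \<open>t\<close>
    satisfying the integer inequality of both bounds.\<close>
  have T_le: "T \<le> t \<longleftrightarrow> 2 * n \<le> t * d" for t
  proof -
    have "T \<le> t \<longleftrightarrow> 2 * real n / real d \<le> real t"
      by (simp add: T_def nat_le_iff ceiling_le_iff)
    also have "\<dots> \<longleftrightarrow> 2 * real n \<le> real t * real d" using d(2) by (simp add: pos_divide_le_eq)
    also have "\<dots> \<longleftrightarrow> real (2 * n) \<le> real (t * d)" by simp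
    also have "\<dots> \<longleftrightarrow> 2 * n \<le> t * d" by (rule of_nat_le_iff)
    finally show ?thesis .
  qed
  have arrow: "ramsey_arrow (complete_multipartite j t) (complete_graph m) (matching_graph n) \<longleftrightarrow> T \<le> t"
    for t
    using ramsey_arrow_upper[of m j n t] not_ramsey_arrow_lower[of m j t n] assms T_le[of t]
    by (auto simp: d_def not_le)
  \<comment> \<open>Positivity makes \<open>T\<close> itself admissible in the infimum.\<close>
  have "0 < T" using T_le[of 0] assms by auto
  then have "Inf {enat t | t. 0 < t \<and> T \<le> t} = enat T"
    by (intro antisym Inf_lower Inf_greatest) auto
  then show ?thesis by (simp add: multipartite_ramsey_def arrow d T_def)
qed

end
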